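(* For all integers $q,n\ge 2$, $N_3(q,n)>2^{f(q,n-1)-1}$.
   Context: $N_3(q,n)$ is the smallest $N$ such that every coloring of the 3-element subsets of $[N]$ with $q$ colors admits integers $j_1<\dots<j_n$ in $[N]$ such that all triples $\{j_i,j_{i+1},j_{i+2}\}$, $1\le i\le n-2$, have the same color. $f(q,m)$ is the smallest $N$ such that every $q$-coloring of the edges of the complete digraph on $N$ vertices (two oppositely directed edges between any two distinct vertices, no loops) contains a monochromatic walk of length $m$, i.e., a sequence of $m$ vertices $v_1,\dots,v_m$ (repetitions allowed) such that all edges $\overrightarrow{v_iv_{i+1}}$ have the same color. *)

theory Defs
  imports Complex_Main "HOL-Library.Ramsey" "HOL-Library.Infinite_Set"
begin

definition mono_path_property :: "nat \<Rightarrow> nat \<Rightarrow> nat \<Rightarrow> bool" where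
  "mono_path_property q n N \<longleftrightarrow>
     (\<forall>c :: nat set \<Rightarrow> nat. c \<in> nsets {1..N} 3 \<rightarrow> {1..q} \<longrightarrow>
        (\<exists>j :: nat \<Rightarrow> nat. j \<in> {1..n} \<rightarrow> {1..N} \<and> strict_mono_on {1..n} j \<and>
           (\<exists>k. \<forall>i. 1 \<le> i \<and> i + 2 \<le> n \<longrightarrow> c {j i, j (i + 1), j (i + 2)} = k)))"

definition N3 :: "nat \<Rightarrow> nat \<Rightarrow> nat" where
  "N3 q n = (LEAST N. mono_path_property q n N)"

definition complete_digraph_edges :: "nat \<Rightarrow> (nat \<times> nat) set" where
  "complete_digraph_edges N = {(u, v). u \<in> {1..N} \<and> v \<in> {1..N} \<and> u \<noteq> v}"

text \<open>The length of a walk is its number of vertices, not of edges. Since the digraph has no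
  loops, consecutive vertices of a walk are distinct.\<close>

definition mono_walk_property :: "nat \<Rightarrow> nat \<Rightarrow> nat \<Rightarrow> bool" where
  "mono_walk_property q m N \<longleftrightarrow>
     (\<forall>c :: nat \<times> nat \<Rightarrow> nat. c \<in> complete_digraph_edges N \<rightarrow> {1..q} \<longrightarrow>
        (\<exists>v :: nat \<Rightarrow> nat. v \<in> {1..m} \<rightarrow> {1..N} \<and>
           (\<forall>i. 1 \<le> i \<and> i + 1 \<le> m \<longrightarrow> (v i, v (i + 1)) \<in> complete_digraph_edges N) \<and>
           (\<exists>k. \<forall>i. 1 \<le> i \<and> i + 1 \<le> m \<longrightarrow> c (v i, v (i + 1)) = k)))"

definition walk_number :: "nat \<Rightarrow> nat \<Rightarrow> nat" where
  "walk_number q m = (LEAST N. mono_walk_property q m N)"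

text \<open>Both minima are attained, by Ramsey's theorem.\<close>

lemma ramsey_increasing_sequence:
  fixes q n r :: nat
  obtains N :: nat where
    "\<And>c :: nat set \<Rightarrow> nat. c \<in> nsets {1..N} r \<rightarrow> {1..q} \<Longrightarrow>
       \<exists>j k. j \<in> {1..n} \<rightarrow> {1..N} \<and> strict_mono_on {1..n} j \<and>
             (\<forall>X \<in> nsets {1..n} r. c (j ` X) = k)"
proof -
  obtain N :: nat where N: "partn_lst {..<N} (replicate q n) r"
    using ramsey_full by blast
  show thesis
  proof (rule that[of N])
    fix c :: "nat set \<Rightarrow> nat"
    assume c: "c \<in> nsets {1..N} r \<rightarrow> {1..q}"
    define d where "d X = c (Suc ` X) - 1" for X
    have cS: "c (Suc ` X) \<in> {1..q}" if "X \<in> nsets {..<N} r" for X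
    proof -
      have "Suc ` X \<in> nsets {1..N} r"
        using that by (auto simp: nsets_def card_image)
      then show ?thesis using c by blast
    qed
    have "d \<in> nsets {..<N} r \<rightarrow> {..<q}"
      using cS by (fastforce simp: d_def)
    then obtain i H where H: "H \<in> nsets {..<N} (replicate q n ! i)" "i < q"
      "d ` nsets H r \<subseteq> {i}"
      using partn_lstE[OF N, of d q] by (metis length_replicate)
    then have HN: "H \<subseteq> {..<N}" "card H = n" "finite H"
      by (auto simp: nsets_def)
    then obtain h where h: "bij_betw h {..<n} H" "strict_mono_on {..<n} h"
      using ex_bij_betw_strict_mono_card by metis
    define j where "j i = Suc (h (i - 1))" for i
    have hH: "h x \<in> H" if "x < n" for x
      using h(1) that by (auto simp: bij_betw_def)
    have 1: "j \<in> {1..n} \<rightarrow> {1..N}"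
    proof
      fix x assume "x \<in> {1..n}"
      then have "x - 1 < n" by auto
      then have "h (x - 1) \<in> {..<N}" using hH HN(1) by blast
      then show "j x \<in> {1..N}" by (auto simp: j_def)
    qed
    have 2: "strict_mono_on {1..n} j"
    proof (rule strict_mono_onI)
      fix x y assume "x \<in> {1..n}" "y \<in> {1..n}" "x < y"
      then have "x - 1 \<in> {..<n}" "y - 1 \<in> {..<n}" "x - 1 < y - 1" by auto
      then show "j x < j y"
        using strict_mono_onD[OF h(2)] by (simp add: j_def)
    qed
    have 3: "c (j ` X) = Suc i" if "X \<in> nsets {1..n} r" for X
    proof -
      have X: "X \<subseteq> {1..n}" "card X = r" "finite X"
        using that by (auto simp: nsets_def)
      let ?Y = "(\<lambda>x. h (x - 1)) ` X"
      have "inj_on j X"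
        using 2 X(1) by (meson inj_on_subset strict_mono_on_imp_inj_on)
      then have "inj_on (\<lambda>x. h (x - 1)) X"
        by (auto simp: inj_on_def j_def)
      moreover have "?Y \<subseteq> H"
      proof
        fix y assume "y \<in> ?Y"
        then obtain x where "x \<in> X" "y = h (x - 1)" by blast
        moreover have "x - 1 < n" using \<open>x \<in> X\<close> X(1) by fastforce
        ultimately show "y \<in> H" using hH by simp
      qed
      ultimately have Y: "?Y \<in> nsets H r"
        using X by (simp add: nsets_def card_image)
      then have "d ?Y = i" using H(3) by blast
      moreover have "c (Suc ` ?Y) \<in> {1..q}"
        using cS Y nsets_mono[OF HN(1)] by blast
      moreover have "Suc ` ?Y = j ` X"
        by (auto simp: j_def image_image)
      ultimately show ?thesis by (auto simp: d_def)
    qed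
    show "\<exists>j k. j \<in> {1..n} \<rightarrow> {1..N} \<and> strict_mono_on {1..n} j \<and>
             (\<forall>X \<in> nsets {1..n} r. c (j ` X) = k)"
      using 1 2 3 by blast
  qed
qed

lemma ex_mono_path_property: "\<exists>N. mono_path_property q n N"
proof -
  obtain N :: nat where N:
    "\<And>c :: nat set \<Rightarrow> nat. c \<in> nsets {1..N} 3 \<rightarrow> {1..q} \<Longrightarrow>
       \<exists>j k. j \<in> {1..n} \<rightarrow> {1..N} \<and> strict_mono_on {1..n} j \<and>
             (\<forall>X \<in> nsets {1..n} 3. c (j ` X) = k)"
    using ramsey_increasing_sequence[of 3 q n] by blast
  have "mono_path_property q n N"
    unfolding mono_path_property_def
  proof (intro allI impI)
    fix c :: "nat set \<Rightarrow> nat"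
    assume "c \<in> nsets {1..N} 3 \<rightarrow> {1..q}"
    then obtain j k where j: "j \<in> {1..n} \<rightarrow> {1..N}" "strict_mono_on {1..n} j"
      "\<And>X. X \<in> nsets {1..n} 3 \<Longrightarrow> c (j ` X) = k"
      using N by blast
    have "c {j i, j (i + 1), j (i + 2)} = k" if "1 \<le> i \<and> i + 2 \<le> n" for i
      using j(3)[of "{i, i + 1, i + 2}"] that by (auto simp: nsets_def)
    with j show "\<exists>j. j \<in> {1..n} \<rightarrow> {1..N} \<and> strict_mono_on {1..n} j \<and>
           (\<exists>k. \<forall>i. 1 \<le> i \<and> i + 2 \<le> n \<longrightarrow> c {j i, j (i + 1), j (i + 2)} = k)"
      by blast
  qed
  then show ?thesis by blast
qed

lemma ex_mono_walk_property: "\<exists>N. mono_walk_property q m N"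
proof -
  obtain N :: nat where N:
    "\<And>c :: nat set \<Rightarrow> nat. c \<in> nsets {1..N} 2 \<rightarrow> {1..q} \<Longrightarrow>
       \<exists>j k. j \<in> {1..m} \<rightarrow> {1..N} \<and> strict_mono_on {1..m} j \<and>
             (\<forall>X \<in> nsets {1..m} 2. c (j ` X) = k)"
    using ramsey_increasing_sequence[of 2 q m] by blast
  have "mono_walk_property q m N"
    unfolding mono_walk_property_def
  proof (intro allI impI)
    fix c :: "nat \<times> nat \<Rightarrow> nat"
    assume c: "c \<in> complete_digraph_edges N \<rightarrow> {1..q}"
    define d where "d X = c (Min X, Max X)" for X
    have "d \<in> nsets {1..N} 2 \<rightarrow> {1..q}"
    proof
      fix X :: "nat set" assume "X \<in> nsets {1..N} 2"
      then obtain x y where "X = {x, y}" "x \<noteq> y" "x \<in> {1..N}" "y \<in> {1..N}"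
        by (auto simp: nsets_def card_2_iff)
      then have "(Min X, Max X) \<in> complete_digraph_edges N"
        by (auto simp: complete_digraph_edges_def min_def max_def)
      then show "d X \<in> {1..q}" using c unfolding d_def by blast
    qed
    then obtain j k where j: "j \<in> {1..m} \<rightarrow> {1..N}" "strict_mono_on {1..m} j"
      "\<And>X. X \<in> nsets {1..m} 2 \<Longrightarrow> d (j ` X) = k"
      using N by blast
    have "(j i, j (i + 1)) \<in> complete_digraph_edges N \<and> c (j i, j (i + 1)) = k"
      if i: "1 \<le> i \<and> i + 1 \<le> m" for i
    proof -
      have lt: "j i < j (i + 1)"
        using j(2) i by (auto simp: strict_mono_on_def)
      have "d {j i, j (i + 1)} = k"
        using j(3)[of "{i, i + 1}"] i by (auto simp: nsets_def)
      moreover have "j i \<in> {1..N}" "j (i + 1) \<in> {1..N}"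
        using j(1) i by (auto simp: Pi_iff)
      ultimately show ?thesis
        using lt by (auto simp: d_def complete_digraph_edges_def min_def max_def)
    qed
    with j(1) show "\<exists>v. v \<in> {1..m} \<rightarrow> {1..N} \<and>
           (\<forall>i. 1 \<le> i \<and> i + 1 \<le> m \<longrightarrow> (v i, v (i + 1)) \<in> complete_digraph_edges N) \<and>
           (\<exists>k. \<forall>i. 1 \<le> i \<and> i + 1 \<le> m \<longrightarrow> c (v i, v (i + 1)) = k)"
      by blast
  qed
  then show ?thesis by blast
qed

lemma walk_number_pos:
  assumes "1 \<le> m"
  shows "1 \<le> walk_number q m"
proof -
  have "mono_walk_property q m (walk_number q m)"
    unfolding walk_number_def by (rule LeastI_ex) (rule ex_mono_walk_property)
  moreover have "\<not> mono_walk_property q m 0"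
    using assms by (auto simp: mono_walk_property_def complete_digraph_edges_def Pi_iff)
  ultimately show ?thesis by (cases "walk_number q m") auto
qed

end

theory Submission
  imports Defs
begin

text \<open>The Erdos--Hajnal stepping-up argument. Put \<open>M = f(q, n-1) - 1\<close> and fix a colouring \<open>\<chi>\<close> of the
  complete digraph on \<open>M\<close> vertices without a monochromatic walk of length \<open>n - 1\<close>. For
  \<open>x < y\<close> below \<open>2^M\<close> let \<open>\<delta>(x, y) \<in> {1..M}\<close> be the highest binary position in which \<open>x\<close> and \<open>y\<close>
  differ. If \<open>x < y < z\<close> then \<open>y\<close> has a 1 in position \<open>\<delta>(x, y)\<close> and a 0 in position \<open>\<delta>(y, z)\<close>, so
  these positions differ and \<open>{x, y, z}\<close> can be given the colour \<open>\<chi>(\<delta>(x, y), \<delta>(y, z))\<close>. A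
  monochromatic path \<open>j\<^sub>1 < \<dots> < j\<^sub>n\<close> would yield the monochromatic walk
  \<open>\<delta>(j\<^sub>1, j\<^sub>2), \<dots>, \<delta>(j\<^sub>n\<^sub>-\<^sub>1, j\<^sub>n)\<close>.\<close>

text \<open>Positions are counted from 1, and the value is 0 for equal arguments.\<close>

definition top_diff :: "nat \<Rightarrow> nat \<Rightarrow> nat" where
  "top_diff x y = (LEAST d. x div 2 ^ d = y div 2 ^ d)"

lemma top_diff_le:
  assumes "x < 2 ^ M" "y < 2 ^ M"
  shows "top_diff x y \<le> M"
  unfolding top_diff_def using assms by (intro Least_le) simp

lemma div_top_diff_eq: "x div 2 ^ top_diff x y = y div 2 ^ top_diff x y"
proof -
  \<comment> \<open>The exponent \<open>x + y\<close> is large enough for both quotients to vanish,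
    so the \<open>LEAST\<close> is attained.\<close>
  have "x div 2 ^ (x + y) = 0" "y div 2 ^ (x + y) = 0"
    by (meson div_less le_add1 le_add2 less_exp order_le_less_trans)+
  then have "x div 2 ^ (x + y) = y div 2 ^ (x + y)" by simp
  then show ?thesis unfolding top_diff_def by (rule LeastI)
qed

lemma top_diff_pos:
  assumes "x < y"
  shows "0 < top_diff x y"
  using div_top_diff_eq[of x y] assms by (cases "top_diff x y") auto

lemma div_less_below_top_diff:
  assumes "x < y" and "d < top_diff x y"
  shows "x div 2 ^ d < y div 2 ^ d"
proof -
  have "x div 2 ^ d \<noteq> y div 2 ^ d"
    using assms(2) not_less_Least unfolding top_diff_def by blast
  moreover have "x div 2 ^ d \<le> y div 2 ^ d"
    using assms(1) by (intro div_le_mono) simp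
  ultimately show ?thesis by simp
qed

lemma top_diff_neq:
  assumes "x < y" "y < z"
  shows "top_diff x y \<noteq> top_diff y z"
proof
  assume eq: "top_diff x y = top_diff y z"
  obtain d where d: "top_diff x y = Suc d"
    using top_diff_pos[OF assms(1)] gr0_implies_Suc by blast
  \<comment> \<open>Three distinct numbers would have the same half, but at most two naturals
    do.\<close>
  let ?a = "x div 2 ^ d" and ?b = "y div 2 ^ d" and ?c = "z div 2 ^ d"
  have "?a < ?b" "?b < ?c"
    using assms d eq by (auto intro: div_less_below_top_diff)
  moreover have "?a div 2 = ?b div 2" "?b div 2 = ?c div 2"
    using div_top_diff_eq[of x y] div_top_diff_eq[of y z] d eq
    by (simp_all add: div_mult2_eq power_Suc2 del: power_Suc)
  ultimately show False by linarith
qed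

text \<open>Subtracting 1 moves the vertices \<open>{1..N}\<close> to numbers below
  \<open>2 ^ M\<close>, even when \<open>N = 2 ^ M\<close>.\<close>

definition step_up :: "(nat \<times> nat \<Rightarrow> nat) \<Rightarrow> nat set \<Rightarrow> nat" where
  "step_up \<chi> X =
     (let x = Min X; y = Min (X - {x}); z = Max X
      in \<chi> (top_diff (x - 1) (y - 1), top_diff (y - 1) (z - 1)))"

lemma step_up_triple:
  assumes "x < y" "y < z"
  shows "step_up \<chi> {x, y, z} = \<chi> (top_diff (x - 1) (y - 1), top_diff (y - 1) (z - 1))"
proof -
  have "Min {x, y, z} = x" "Max {x, y, z} = z" "{x, y, z} - {x} = {y, z}" "Min {y, z} = y"
    using assms by auto
  then show ?thesis by (simp add: step_up_def)
qed

lemma top_diff_mem: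
  assumes "x < y" "x \<in> {1..N}" "y \<in> {1..N}" "N \<le> 2 ^ M"
  shows "top_diff (x - 1) (y - 1) \<in> {1..M}"
proof -
  have "x - 1 < y - 1" "x - 1 < 2 ^ M" "y - 1 < 2 ^ M"
    using assms by auto
  then show ?thesis
    using top_diff_pos[of "x - 1" "y - 1"] top_diff_le[of "x - 1" M "y - 1"] by simp
qed

lemma top_diff_edge:
  assumes "x < y" "y < z" "x \<in> {1..N}" "y \<in> {1..N}" "z \<in> {1..N}" "N \<le> 2 ^ M"
  shows "(top_diff (x - 1) (y - 1), top_diff (y - 1) (z - 1)) \<in> complete_digraph_edges M"
proof -
  have "x - 1 < y - 1" "y - 1 < z - 1"
    using assms by auto
  then show ?thesis
    using top_diff_neq top_diff_mem assms unfolding complete_digraph_edges_def by blast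
qed

lemma nsets_3_sorted:
  fixes A :: "'a::linorder set"
  assumes "X \<in> nsets A 3"
  obtains x y z where "x < y" "y < z" "X = {x, y, z}" "x \<in> A" "y \<in> A" "z \<in> A"
proof -
  have X: "X \<subseteq> A" "card X = 3" using assms by (auto simp: nsets_def)
  define xs where "xs = sorted_list_of_set X"
  have fin: "finite X" using X(2) card.infinite by fastforce
  then have "length xs = 3" "sorted_wrt (<) xs" "set xs = X"
    using X(2) by (simp_all add: xs_def)
  then obtain x y z where "xs = [x, y, z]"
    by (auto simp: numeral_3_eq_3 length_Suc_conv)
  with \<open>sorted_wrt (<) xs\<close> \<open>set xs = X\<close> X(1) show thesis
    by (intro that[of x y z]) auto
qed

lemma mono_path_imp_mono_walk:
  assumes path: "mono_path_property q n N" and N: "N \<le> 2 ^ M"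
  shows "mono_walk_property q (n - 1) M"
  unfolding mono_walk_property_def
proof (intro allI impI)
  fix \<chi> :: "nat \<times> nat \<Rightarrow> nat"
  assume \<chi>: "\<chi> \<in> complete_digraph_edges M \<rightarrow> {1..q}"
  have "step_up \<chi> \<in> nsets {1..N} 3 \<rightarrow> {1..q}"
  proof
    fix X :: "nat set" assume "X \<in> nsets {1..N} 3"
    then obtain x y z where xyz: "x < y" "y < z" "X = {x, y, z}"
      "x \<in> {1..N}" "y \<in> {1..N}" "z \<in> {1..N}"
      by (rule nsets_3_sorted)
    then show "step_up \<chi> X \<in> {1..q}"
      using top_diff_edge[OF xyz(1,2,4-6) N] \<chi> by (auto simp: step_up_triple)
  qed
  then obtain j k where j: "j \<in> {1..n} \<rightarrow> {1..N}" "strict_mono_on {1..n} j"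
    and k: "\<And>i. 1 \<le> i \<Longrightarrow> i + 2 \<le> n \<Longrightarrow> step_up \<chi> {j i, j (i + 1), j (i + 2)} = k"
    using path unfolding mono_path_property_def by blast
  \<comment> \<open>The \<open>n\<close> path vertices have \<open>n - 1\<close> gaps. Two
    successive gaps span a triple of the path, whose colour is that of the edge between their
    \<open>top_diff\<close> values.\<close>
  define v where "v i = top_diff (j i - 1) (j (i + 1) - 1)" for i
  have jN: "j i \<in> {1..N}" if "1 \<le> i" "i \<le> n" for i
    using j(1) that by auto
  have less: "j i < j (i + 1)" if "1 \<le> i" "i + 1 \<le> n" for i
    using j(2) that by (auto simp: strict_mono_on_def)
  have "v \<in> {1..n - 1} \<rightarrow> {1..M}"
  proof
    fix i assume "i \<in> {1..n - 1}"
    then have "1 \<le> i" "i + 1 \<le> n" by auto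
    then show "v i \<in> {1..M}"
      unfolding v_def by (intro top_diff_mem[OF _ _ _ N] less jN) auto
  qed
  moreover have "(v i, v (i + 1)) \<in> complete_digraph_edges M \<and> \<chi> (v i, v (i + 1)) = k"
    if "1 \<le> i \<and> i + 1 \<le> n - 1" for i
  proof -
    have i: "1 \<le> i" "i + 2 \<le> n" using that by auto
    have lt: "j i < j (i + 1)" "j (i + 1) < j (i + 2)"
      using less[of i] less[of "i + 1"] i by auto
    have "(v i, v (i + 1)) \<in> complete_digraph_edges M"
      using top_diff_edge[OF lt jN jN jN N] i by (simp add: v_def)
    moreover have "\<chi> (v i, v (i + 1)) = k"
      using k[OF i] step_up_triple[OF lt, of \<chi>] by (simp add: v_def)
    ultimately show ?thesis by simp
  qed
  ultimately show "\<exists>v. v \<in> {1..n - 1} \<rightarrow> {1..M} \<and>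
      (\<forall>i. 1 \<le> i \<and> i + 1 \<le> n - 1 \<longrightarrow> (v i, v (i + 1)) \<in> complete_digraph_edges M) \<and>
      (\<exists>k. \<forall>i. 1 \<le> i \<and> i + 1 \<le> n - 1 \<longrightarrow> \<chi> (v i, v (i + 1)) = k)"
    by blast
qed

theorem theorem10:
  fixes q n :: nat
  assumes "2 \<le> q" and "2 \<le> n"
  shows "N3 q n > 2 ^ (walk_number q (n - 1) - 1)"
proof (rule ccontr)
  let ?M = "walk_number q (n - 1) - 1"
  assume "\<not> N3 q n > 2 ^ ?M"
  moreover have "mono_path_property q n (N3 q n)"
    unfolding N3_def by (rule LeastI_ex) (rule ex_mono_path_property)
  ultimately have "mono_walk_property q (n - 1) ?M"
    by (intro mono_path_imp_mono_walk) auto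
  then have "walk_number q (n - 1) \<le> ?M"
    unfolding walk_number_def by (rule Least_le)
  \<comment> \<open>Subtraction is truncated: were the walk number 0, \<open>?M\<close> would equal
    it and minimality would give no contradiction.\<close>
  moreover have "1 \<le> walk_number q (n - 1)"
    using assms(2) by (intro walk_number_pos) simp
  ultimately show False by simp
qed

end
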